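(* Let $a>0$, $i_1,i_3>0$, $\mu_r>0$, $C\in\mathbb R$, and consider the system for $(\boldsymbol\omega,\boldsymbol\gamma)\in\mathbb R^3\times\mathbb R^3$ $$\mathbf J\dot{\boldsymbol\omega}+\boldsymbol\omega\times\mathbf I\boldsymbol\omega+\big((\boldsymbol\omega,\tfrac{d}{dt}(\boldsymbol r\times\boldsymbol\gamma))-1\big)\,\boldsymbol r\times\boldsymbol\gamma=-\mu_r\,\boldsymbol\gamma\times(\boldsymbol\omega\times\boldsymbol\gamma),\qquad \dot{\boldsymbol\gamma}+\boldsymbol\omega\times\boldsymbol\gamma=0 .$$ Let $\sigma_l$ be its fixed point $\boldsymbol\gamma=(0,0,-1)$, $\boldsymbol\omega=(0,0,-C/i_3)$ (lower vertical rotation). If $i_1\le i_3$, then $\sigma_l$ is linearly stable for every $C$. If $i_1>i_3$, then $\sigma_l$ is linearly stable if and only if $|C|<C^*$, where $C^*=\dfrac{i_3\sqrt a}{\sqrt{|i_1-i_3|}}$.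
   Context: The system describes, in dimensionless variables (mass, radius and gravitational acceleration equal to $1$), the rolling with slipping of an axisymmetric unbalanced ball on a plane when the only dissipative action is the horizontal rolling resistance torque $-\mu_r\boldsymbol\omega_\bot$, $\boldsymbol\omega_\bot=\boldsymbol\omega-(\boldsymbol\omega,\boldsymbol\gamma)\boldsymbol\gamma$. Notation: $\mathbf I=\mathrm{diag}(i_1,i_1,i_3)$, $\boldsymbol a=(0,0,a)$, $\boldsymbol r=-\boldsymbol\gamma-\boldsymbol a$, $\mathbf J=\mathbf I+(\boldsymbol r\times\boldsymbol\gamma)\otimes(\boldsymbol r\times\boldsymbol\gamma)$ with $(\boldsymbol x\otimes\boldsymbol y)_{ij}=x_iy_j$; thus $\boldsymbol r\times\boldsymbol\gamma=(a\gamma_2,-a\gamma_1,0)$ and $\frac{d}{dt}(\boldsymbol r\times\boldsymbol\gamma)=-\boldsymbol a\times(\boldsymbol\gamma\times\boldsymbol\omega)$. $C$ is the value of the area integral $(\mathbf J\boldsymbol\omega,\boldsymbol\gamma)$. The characteristic polynomial of the linearization of the six-dimensional system at such a fixed point has the form $\lambda^2P_4(\lambda)$, the two zero eigenvalues corresponding to the integrals $(\boldsymbol\gamma,\boldsymbol\gamma)$ and $(\mathbf J\boldsymbol\omega,\boldsymbol\gamma)$; the fixed point is called linearly stable if all four roots of $P_4$ have negative real parts. *)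

theory Defs
  imports "Jordan_Normal_Form.Char_Poly" "HOL-Analysis.Analysis"
begin

no_notation Matrix.vec_index (infixl \<open>$\<close> 100)
no_notation Matrix.scalar_prod (infix \<open>\<bullet>\<close> 70)
unbundle cross3_syntax

definition inertia :: "real \<Rightarrow> real \<Rightarrow> real^3^3" where
  "inertia i1 i3 = vector [vector [i1, 0, 0], vector [0, i1, 0], vector [0, 0, i3]]"

definition offset :: "real \<Rightarrow> real^3" where
  "offset a = vector [0, 0, a]"

definition contact :: "real \<Rightarrow> real^3 \<Rightarrow> real^3" where
  "contact a \<gamma> = - \<gamma> - offset a"

definition arm :: "real \<Rightarrow> real^3 \<Rightarrow> real^3" where
  "arm a \<gamma> = contact a \<gamma> \<times> \<gamma>"

text \<open>The time derivative of \<open>arm a \<gamma>\<close> along a solution; see \<open>arm_has_vector_derivative\<close>.\<close>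

definition arm_rate :: "real \<Rightarrow> real^3 \<Rightarrow> real^3 \<Rightarrow> real^3" where
  "arm_rate a \<omega> \<gamma> = - (offset a \<times> (\<gamma> \<times> \<omega>))"

definition dyad :: "real^3 \<Rightarrow> real^3 \<Rightarrow> real^3^3" where
  "dyad x y = (\<chi> i j. x $ i * y $ j)"

definition J_mat :: "real \<Rightarrow> real \<Rightarrow> real \<Rightarrow> real^3 \<Rightarrow> real^3^3" where
  "J_mat a i1 i3 \<gamma> = inertia i1 i3 + dyad (arm a \<gamma>) (arm a \<gamma>)"

definition area_integral :: "real \<Rightarrow> real \<Rightarrow> real \<Rightarrow> (real^3) \<times> (real^3) \<Rightarrow> real" where
  "area_integral a i1 i3 = (\<lambda>(\<omega>, \<gamma>). (J_mat a i1 i3 \<gamma> *v \<omega>) \<bullet> \<gamma>)"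

text \<open>The equations of motion, as a relation between a state \<open>(\<omega>, \<gamma>)\<close> and its velocity
  \<open>(\<omega>', \<gamma>')\<close>.\<close>

definition rolling_equations ::
    "real \<Rightarrow> real \<Rightarrow> real \<Rightarrow> real \<Rightarrow> (real^3) \<times> (real^3) \<Rightarrow> (real^3) \<times> (real^3) \<Rightarrow> bool" where
  "rolling_equations a i1 i3 mu_r = (\<lambda>(\<omega>, \<gamma>) (\<omega>', \<gamma>').
     J_mat a i1 i3 \<gamma> *v \<omega>' + \<omega> \<times> (inertia i1 i3 *v \<omega>)
         + (\<omega> \<bullet> arm_rate a \<omega> \<gamma> - 1) *\<^sub>R arm a \<gamma>
       = - (mu_r *\<^sub>R (\<gamma> \<times> (\<omega> \<times> \<gamma>)))
     \<and> \<gamma>' + \<omega> \<times> \<gamma> = 0)"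

text \<open>The same system solved for the velocity; see \<open>rolling_equations_iff\<close>.\<close>

definition rolling_field ::
    "real \<Rightarrow> real \<Rightarrow> real \<Rightarrow> real \<Rightarrow> (real^3) \<times> (real^3) \<Rightarrow> (real^3) \<times> (real^3)" where
  "rolling_field a i1 i3 mu_r = (\<lambda>(\<omega>, \<gamma>).
     (matrix_inv (J_mat a i1 i3 \<gamma>) *v
        (- (mu_r *\<^sub>R (\<gamma> \<times> (\<omega> \<times> \<gamma>))) - \<omega> \<times> (inertia i1 i3 *v \<omega>)
           - (\<omega> \<bullet> arm_rate a \<omega> \<gamma> - 1) *\<^sub>R arm a \<gamma>),
      - (\<omega> \<times> \<gamma>)))"

definition sigma_l :: "real \<Rightarrow> real \<Rightarrow> (real^3) \<times> (real^3)" where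
  "sigma_l i3 C = (vector [0, 0, - C / i3], vector [0, 0, - 1])"

definition state_basis :: "((real^3) \<times> (real^3)) list" where
  "state_basis = [(axis 1 1, 0), (axis 2 1, 0), (axis 3 1, 0),
                  (0, axis 1 1), (0, axis 2 1), (0, axis 3 1)]"

definition jacobian_mat ::
    "((real^3) \<times> (real^3) \<Rightarrow> (real^3) \<times> (real^3)) \<Rightarrow> (real^3) \<times> (real^3) \<Rightarrow> real mat" where
  "jacobian_mat F s =
     Matrix.mat 6 6 (\<lambda>(i, j). frechet_derivative F (at s) (state_basis ! j) \<bullet> (state_basis ! i))"

text \<open>The characteristic polynomial of the linearization is \<open>\<lambda>\<^sup>2 P4(\<lambda>)\<close>; the two zero
  eigenvalues produced by the integrals are discarded, and all complex roots of \<open>P4\<close> have to lie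
  in the open left half-plane. For \<open>rolling_field\<close> at \<open>sigma_l\<close> the factorization exists by
  \<open>char_poly_sigma_l\<close>, and \<open>P4\<close> is unique.\<close>

definition linearly_stable ::
    "((real^3) \<times> (real^3) \<Rightarrow> (real^3) \<times> (real^3)) \<Rightarrow> (real^3) \<times> (real^3) \<Rightarrow> bool" where
  "linearly_stable F s \<longleftrightarrow>
     (\<exists>P4 :: real poly. char_poly (jacobian_mat F s) = monom 1 2 * P4 \<and>
        (\<forall>z :: complex. poly (map_poly complex_of_real P4) z = 0 \<longrightarrow> Re z < 0))"

definition C_star :: "real \<Rightarrow> real \<Rightarrow> real \<Rightarrow> real" where
  "C_star a i1 i3 = i3 * sqrt a / sqrt \<bar>i1 - i3\<bar>"


subsection \<open>Consistency of the setup\<close>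

lemma arm_eq: "arm a \<gamma> = vector [a * \<gamma> $ 2, - a * \<gamma> $ 1, 0]"
  by (simp add: arm_def contact_def offset_def cross3_simps forall_3)

lemma arm_has_vector_derivative:
  assumes "(\<gamma> has_vector_derivative - (\<omega> \<times> \<gamma> t)) (at t)"
  shows "((\<lambda>t. arm a (\<gamma> t)) has_vector_derivative arm_rate a \<omega> (\<gamma> t)) (at t)"
proof -
  have eq: "arm a x = - (offset a \<times> x)" for x
    by (simp add: arm_def contact_def cross3_simps forall_3)
  have bl: "bounded_linear (\<lambda>x. - (offset a \<times> x))"
    by (intro bounded_linear_minus linear_conv_bounded_linear[THEN iffD1] linearI)
       (simp_all add: cross_add_right cross_mult_right)
  have "- (\<omega> \<times> \<gamma> t) = \<gamma> t \<times> \<omega>" by (metis cross_skew)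
  with bounded_linear.has_vector_derivative[OF bl assms] show ?thesis
    by (simp add: eq arm_rate_def)
qed

lemma J_mat_mult: "J_mat a i1 i3 \<gamma> *v x =
  vector [i1 * x $ 1 + (arm a \<gamma> \<bullet> x) * arm a \<gamma> $ 1,
          i1 * x $ 2 + (arm a \<gamma> \<bullet> x) * arm a \<gamma> $ 2,
          i3 * x $ 3]"
  by (simp add: J_mat_def inertia_def dyad_def arm_eq matrix_vector_mult_def sum_3 vec_eq_iff
      forall_3 inner_vec_def algebra_simps)

definition J_solve :: "real \<Rightarrow> real \<Rightarrow> real^3 \<Rightarrow> real^3 \<Rightarrow> real^3" where
  "J_solve i1 i3 v b = (let k = (v \<bullet> b) / (i1 + v \<bullet> v) in
     vector [(b $ 1 - k * v $ 1) / i1, (b $ 2 - k * v $ 2) / i1, b $ 3 / i3])"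

lemma J_mat_invertible:
  assumes "i1 > 0" "i3 > 0"
  shows "invertible (J_mat a i1 i3 \<gamma>)"
proof -
  have "x = 0" if "J_mat a i1 i3 \<gamma> *v x = 0" for x
  proof -
    have "x \<bullet> (J_mat a i1 i3 \<gamma> *v x) =
        i1 * (x $ 1)\<^sup>2 + i1 * (x $ 2)\<^sup>2 + i3 * (x $ 3)\<^sup>2 + (arm a \<gamma> \<bullet> x)\<^sup>2"
      by (simp add: J_mat_mult inner_vec_def sum_3 arm_eq power2_eq_square algebra_simps)
    then have s: "i1 * (x $ 1)\<^sup>2 + i1 * (x $ 2)\<^sup>2 + i3 * (x $ 3)\<^sup>2 + (arm a \<gamma> \<bullet> x)\<^sup>2 = 0"
      using that by simp
    have "0 \<le> i1 * (x $ 1)\<^sup>2" "0 \<le> i1 * (x $ 2)\<^sup>2" "0 \<le> i3 * (x $ 3)\<^sup>2" "0 \<le> (arm a \<gamma> \<bullet> x)\<^sup>2"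
      using assms by simp_all
    then have "i1 * (x $ 1)\<^sup>2 = 0" "i1 * (x $ 2)\<^sup>2 = 0" "i3 * (x $ 3)\<^sup>2 = 0"
      using s by linarith+
    with assms show "x = 0" by (simp add: vec_eq_iff forall_3)
  qed
  then show ?thesis
    by (simp add: invertible_left_inverse matrix_left_invertible_ker)
qed

lemma matrix_inv_mult_eq_iff:
  fixes A :: "real^3^3"
  assumes "invertible A"
  shows "x = matrix_inv A *v b \<longleftrightarrow> A *v x = b"
proof -
  have inv: "A ** matrix_inv A = Finite_Cartesian_Product.mat 1 \<and>
      matrix_inv A ** A = Finite_Cartesian_Product.mat 1"
    using assms unfolding matrix_inv_def invertible_def by (rule someI_ex)
  show ?thesis
  proof
    assume "x = matrix_inv A *v b"
    then show "A *v x = b"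
      using inv by (simp add: matrix_vector_mul_assoc)
  next
    assume "A *v x = b"
    then have "matrix_inv A *v b = (matrix_inv A ** A) *v x"
      by (metis matrix_vector_mul_assoc)
    then show "x = matrix_inv A *v b"
      using inv by simp
  qed
qed

lemma rolling_equations_iff:
  assumes "i1 > 0" "i3 > 0"
  shows "rolling_equations a i1 i3 mu_r s s' \<longleftrightarrow> s' = rolling_field a i1 i3 mu_r s"
proof -
  have *: "x + b + c = d \<longleftrightarrow> x = d - b - c" for x b c d :: "real^3"
    by (auto simp: algebra_simps)
  have **: "x + b = 0 \<longleftrightarrow> x = - b" for x b :: "real^3"
    by (auto simp: eq_neg_iff_add_eq_0)
  show ?thesis
    by (cases s, cases s')
       (simp add: rolling_equations_def rolling_field_def * ** 
          matrix_inv_mult_eq_iff[OF J_mat_invertible[OF assms]])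
qed

lemma rolling_field_eq:
  assumes "i1 > 0" "i3 > 0"
  shows "rolling_field a i1 i3 mu_r (\<omega>, \<gamma>) =
    (J_solve i1 i3 (arm a \<gamma>)
        (- (mu_r *\<^sub>R (\<gamma> \<times> (\<omega> \<times> \<gamma>))) - \<omega> \<times> (inertia i1 i3 *v \<omega>)
           - (\<omega> \<bullet> arm_rate a \<omega> \<gamma> - 1) *\<^sub>R arm a \<gamma>),
      - (\<omega> \<times> \<gamma>))"
proof -
  have "J_mat a i1 i3 \<gamma> *v J_solve i1 i3 (arm a \<gamma>) b = b" for b
  proof -
    define v where "v = arm a \<gamma>"
    define k where "k = (v \<bullet> b) / (i1 + v \<bullet> v)"
    have pos: "i1 + v \<bullet> v > 0" using assms by (simp add: add_pos_nonneg)
    have v3: "v $ 3 = 0" by (simp add: v_def arm_eq)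
    have J: "J_solve i1 i3 v b = vector [(b $ 1 - k * v $ 1) / i1, (b $ 2 - k * v $ 2) / i1, b $ 3 / i3]"
      by (simp add: J_solve_def k_def)
    have "v \<bullet> J_solve i1 i3 v b = (v \<bullet> b - k * (v \<bullet> v)) / i1"
      using assms by (simp add: J inner_vec_def sum_3 v3 field_simps)
    also have "\<dots> = k"
    proof -
      have "k * (i1 + v \<bullet> v) = v \<bullet> b" using pos by (simp add: k_def)
      then have "v \<bullet> b - k * (v \<bullet> v) = k * i1" by (simp add: algebra_simps)
      then show ?thesis using assms by simp
    qed
    finally have vk: "v \<bullet> J_solve i1 i3 v b = k" .
    show ?thesis
      unfolding J_mat_mult v_def[symmetric] vk
      using assms by (simp add: J vec_eq_iff forall_3)
  qed
  then show ?thesis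
    by (simp add: rolling_field_def
        matrix_inv_mult_eq_iff[OF J_mat_invertible[OF assms], symmetric])
qed

lemma sigma_l_fixed_point:
  assumes "i1 > 0" "i3 > 0"
  shows "rolling_field a i1 i3 mu_r (sigma_l i3 C) = 0"
  unfolding sigma_l_def rolling_field_eq[OF assms]
  by (simp add: J_solve_def arm_eq inertia_def matrix_vector_mult_def cross3_simps forall_3 zero_prod_def)

lemma area_integral_sigma_l: "i3 \<noteq> 0 \<Longrightarrow> area_integral a i1 i3 (sigma_l i3 C) = C"
  by (simp add: area_integral_def sigma_l_def J_mat_mult inner_vec_def sum_3)

lemma rolling_field_differentiable:
  assumes "i1 > 0" "i3 > 0"
  shows "rolling_field a i1 i3 mu_r differentiable (at s)"
proof -
  have w: "(\<lambda>s. fst s $ i) differentiable (at s)" for s :: "(real^3) \<times> (real^3)" and i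
    by (rule bounded_linear_imp_differentiable)
       (intro bounded_linear_compose[OF bounded_linear_vec_nth] bounded_linear_fst)
  have g: "(\<lambda>s. snd s $ i) differentiable (at s)" for s :: "(real^3) \<times> (real^3)" and i
    by (rule bounded_linear_imp_differentiable)
       (intro bounded_linear_compose[OF bounded_linear_vec_nth] bounded_linear_snd)
  have ne: "i1 + (a * x * (a * x) + a * y * (a * y)) \<noteq> 0" for x y :: real
  proof -
    have "0 \<le> a * x * (a * x)" "0 \<le> a * y * (a * y)" by simp_all
    with assms show ?thesis by linarith
  qed
  have nz: "i1 \<noteq> 0" "i3 \<noteq> 0" using assms by auto
  have vi: "vector [x, y, z] \<bullet> v = x * v $ 1 + y * v $ 2 + z * v $ 3"
    for x y z :: real and v :: "real^3"
    by (simp add: inner_vec_def sum_3)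
  have wi: "fst s \<bullet> v = fst s $ 1 * v $ 1 + fst s $ 2 * v $ 2 + fst s $ 3 * v $ 3"
    for s :: "(real^3) \<times> (real^3)" and v
    by (simp add: inner_vec_def sum_3)
  let ?F = "rolling_field a i1 i3 mu_r"
  have 1: "\<forall>k. (\<lambda>s. ?F (fst s, snd s) \<bullet> (axis k 1, 0)) differentiable (at s)"
    unfolding rolling_field_eq[OF assms] forall_3
    by (intro conjI;
        simp add: J_solve_def Let_def arm_eq arm_rate_def vi wi offset_def inertia_def
          matrix_vector_mult_def sum_3 cross3_def inner_axis;
        intro differentiable_add differentiable_diff differentiable_minus differentiable_mult
          differentiable_divide differentiable_const w g;
        (rule ne nz)?)
  have 2: "\<forall>k. (\<lambda>s. ?F (fst s, snd s) \<bullet> (0, axis k 1)) differentiable (at s)"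
    unfolding rolling_field_eq[OF assms] forall_3
    by (intro conjI; simp add: cross3_def inner_axis;
        intro differentiable_diff differentiable_mult w g)
  have "(\<lambda>s. ?F s \<bullet> b) differentiable (at s)" if "b \<in> Basis" for b
  proof -
    from that obtain k where "b = (axis k 1, 0) \<or> b = (0, axis k 1)"
      unfolding Basis_prod_def Basis_vec_def by auto
    then show ?thesis
      using 1[rule_format, of k] 2[rule_format, of k] unfolding prod.collapse by (elim disjE) simp_all
  qed
  then show ?thesis
    by (subst differentiable_componentwise_within) simp
qed

lemma char_poly_zero_row:
  fixes A :: "'a :: comm_ring_1 mat"
  assumes A: "A \<in> carrier_mat (Suc n) (Suc n)" and i: "i \<le> n"
    and z: "\<And>j. j \<le> n \<Longrightarrow> A $$ (i, j) = 0"
  shows "char_poly A = [:0, 1:] * char_poly (mat_delete A i i)"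
proof -
  let ?M = "char_poly_matrix A"
  have M: "?M \<in> carrier_mat (Suc n) (Suc n)" using A by simp
  have e: "?M $$ (i, j) = (if j = i then [:0, 1:] else 0)" if "j < Suc n" for j
    using A i that z by (auto simp: char_poly_matrix_def)
  have "char_poly A = (\<Sum>j<Suc n. ?M $$ (i, j) * cofactor ?M i j)"
    unfolding char_poly_def using i by (intro laplace_expansion_row[OF M]) simp
  also have "\<dots> = (\<Sum>j<Suc n. if j = i then [:0, 1:] * cofactor ?M i j else 0)"
    using e by (intro sum.cong) auto
  also have "\<dots> = [:0, 1:] * cofactor ?M i i"
    using i by (simp add: sum.delta del: sum.lessThan_Suc)
  also have "cofactor ?M i i = Determinant.det (mat_delete ?M i i)"
    by (simp add: cofactor_def flip: mult_2)
  also have "mat_delete ?M i i = char_poly_matrix (mat_delete A i i)"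
    using A i by (intro eq_matI) (auto simp: mat_delete_def char_poly_matrix_def)
  finally show ?thesis by (simp add: char_poly_def)
qed

lemma jacobian_row_zero:
  assumes "i1 > 0" "i3 > 0" "i = 2 \<or> i = 5" "j < 6"
  shows "jacobian_mat (rolling_field a i1 i3 mu_r) (sigma_l i3 C) $$ (i, j) = 0"
proof -
  let ?F = "rolling_field a i1 i3 mu_r" and ?s = "sigma_l i3 C"
  let ?D = "frechet_derivative ?F (at ?s)"
  have D: "(?F has_derivative ?D) (at ?s)"
    using rolling_field_differentiable[OF assms(1,2)] by (simp add: frechet_derivative_works)
  have w: "((\<lambda>s. fst s $ k) has_derivative (\<lambda>h. fst h $ k)) (at s)"
    for s :: "(real^3) \<times> (real^3)" and k
    by (rule bounded_linear_imp_has_derivative)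
       (intro bounded_linear_compose[OF bounded_linear_vec_nth] bounded_linear_fst)
  have g: "((\<lambda>s. snd s $ k) has_derivative (\<lambda>h. snd h $ k)) (at s)"
    for s :: "(real^3) \<times> (real^3)" and k
    by (rule bounded_linear_imp_has_derivative)
       (intro bounded_linear_compose[OF bounded_linear_vec_nth] bounded_linear_snd)
  define f5 where "f5 = (\<lambda>s :: (real^3) \<times> (real^3).
    fst s $ 2 * snd s $ 1 - fst s $ 1 * snd s $ 2)"
  define f2 where "f2 = (\<lambda>s :: (real^3) \<times> (real^3). - (mu_r / i3) * (fst s $ 3 * (snd s $ 1 * snd s $ 1 + snd s $ 2 * snd s $ 2)
      - snd s $ 3 * (fst s $ 1 * snd s $ 1 + fst s $ 2 * snd s $ 2)))"
  have "(\<lambda>s. ?F s \<bullet> (axis 3 1, 0)) = f2"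
  proof
    fix s :: "(real^3) \<times> (real^3)"
    have "?F (fst s, snd s) \<bullet> (axis 3 1, 0) = f2 s"
      unfolding rolling_field_eq[OF assms(1,2)] using assms(1,2)
      by (simp add: f2_def J_solve_def Let_def arm_eq inertia_def matrix_vector_mult_def sum_3
          inner_axis cross3_def field_simps)
    then show "?F s \<bullet> (axis 3 1, 0) = f2 s" by simp
  qed
  moreover have "(\<lambda>s. ?F s \<bullet> (0, axis 3 1)) = f5"
  proof
    fix s :: "(real^3) \<times> (real^3)"
    have "?F (fst s, snd s) \<bullet> (0, axis 3 1) = f5 s"
      unfolding rolling_field_eq[OF assms(1,2)]
      by (simp add: f5_def inner_axis cross3_def algebra_simps)
    then show "?F s \<bullet> (0, axis 3 1) = f5 s" by simp
  qed
  moreover have "(f2 has_derivative (\<lambda>h. 0)) (at ?s)"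
    unfolding f2_def
    by (rule has_derivative_eq_rhs, (rule derivative_intros w g)+) (simp add: sigma_l_def)
  moreover have "(f5 has_derivative (\<lambda>h. 0)) (at ?s)"
    unfolding f5_def
    by (rule has_derivative_eq_rhs, (rule derivative_intros w g)+) (simp add: sigma_l_def)
  moreover have "((\<lambda>s. ?F s \<bullet> c) has_derivative (\<lambda>h. ?D h \<bullet> c)) (at ?s)" for c
    using D by (rule has_derivative_inner_left)
  ultimately have "(\<lambda>h. ?D h \<bullet> (axis 3 1, 0)) = (\<lambda>h. 0)" "(\<lambda>h. ?D h \<bullet> (0, axis 3 1)) = (\<lambda>h. 0)"
    by (metis has_derivative_unique)+
  then have "?D h \<bullet> (state_basis ! i) = 0" for h
    using assms(3) by (auto simp: state_basis_def dest: fun_cong)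
  moreover have "i < 6" using assms(3) by auto
  ultimately show ?thesis using assms(4) by (simp add: jacobian_mat_def)
qed

lemma char_poly_sigma_l:
  assumes "i1 > 0" "i3 > 0"
  shows "\<exists>P4. degree P4 = 4 \<and>
    char_poly (jacobian_mat (rolling_field a i1 i3 mu_r) (sigma_l i3 C)) = monom 1 2 * P4"
proof -
  define A where "A = jacobian_mat (rolling_field a i1 i3 mu_r) (sigma_l i3 C)"
  define B where "B = mat_delete A 5 5"
  have A: "A \<in> carrier_mat 6 6" by (simp add: A_def jacobian_mat_def)
  then have B: "B \<in> carrier_mat 5 5" by (auto simp: B_def mat_delete_def)
  have B2: "mat_delete B 2 2 \<in> carrier_mat 4 4" using B by (auto simp: mat_delete_def)
  have "char_poly A = [:0, 1:] * char_poly B"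
    unfolding B_def
    by (rule char_poly_zero_row[where n = 5])
       (use A in \<open>auto simp: A_def intro!: jacobian_row_zero[OF assms]\<close>)
  also have "char_poly B = [:0, 1:] * char_poly (mat_delete B 2 2)"
  proof (rule char_poly_zero_row[where n = 4])
    show "B $$ (2, j) = 0" if "j \<le> 4" for j
    proof -
      have "B $$ (2, j) = A $$ (2, j)" using A that by (simp add: B_def mat_delete_def)
      also have "\<dots> = 0" unfolding A_def using that by (intro jacobian_row_zero[OF assms]) auto
      finally show ?thesis .
    qed
  qed (use B in auto)
  finally have "char_poly A = monom 1 2 * char_poly (mat_delete B 2 2)"
    by (simp add: monom_altdef power2_eq_square algebra_simps)
  then show ?thesis
    using degree_monic_char_poly[OF B2] unfolding A_def by blast
qed

end

theory Submission
  imports Defs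
begin

text \<open>
  Write \<open>\<Omega> = - C / i3\<close> for the spin of the lower vertical rotation. Everything about it is
  invariant under rotation around the vertical, so in the complex coordinates
  \<open>z = \<omega>\<^sub>1 + \<i> \<omega>\<^sub>2\<close> and \<open>g = \<gamma>\<^sub>1 + \<i> \<gamma>\<^sub>2\<close> the linearization becomes the complex \<open>2 \<times> 2\<close> system
  \<open>i1 z' = (\<i> (i3 - i1) \<Omega> - mu_r) z - (\<i> a + mu_r \<Omega>) g\<close>, \<open>g' = - \<i> (z + \<Omega> g)\<close>, while the two
  vertical directions only contribute the eigenvalue zero. The characteristic polynomial of this
  system is \<open>q(\<lambda>) = \<lambda>\<^sup>2 + (m + \<i> n) \<lambda> + k\<close>, where \<open>m = mu_r / i1\<close>,
  \<open>n = (2 i1 - i3) \<Omega> / i1\<close> and \<open>k = (a + (i3 - i1) \<Omega>\<^sup>2) / i1\<close>; the contributions of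
  the resistance to the constant term cancel, so \<open>k\<close> is real. As a real polynomial,
  \<open>P4\<close> is the product of \<open>q\<close> and its conjugate.

  The roots of \<open>q\<close> have product \<open>k\<close> and sum \<open>- (m + \<i> n)\<close>. Since \<open>k\<close> is real, their real parts
  have the same sign if \<open>k > 0\<close>, and then both are negative because they add up to
  \<open>- m < 0\<close>; for \<open>k < 0\<close> the signs are opposite, and for \<open>k = 0\<close> one root is zero. Hence the
  rotation is stable if and only if \<open>k > 0\<close>, that is, \<open>(i1 - i3) C\<^sup>2 < a i3\<^sup>2\<close>. This is automatic
  for \<open>i1 \<le> i3\<close> and says \<open>\<bar>C\<bar> < C_star a i1 i3\<close> otherwise.

  The linear system is \<open>linearization_coordinates\<close>, the form of \<open>P4\<close> is \<open>char_poly_jacobian\<close>, and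
  the criterion \<open>k > 0\<close> is \<open>quartic_left_half_plane_iff\<close>.
\<close>

section \<open>Linearization at the lower vertical rotation\<close>

lemma has_derivative_cross3:
  assumes "(f has_derivative f') (at x within S)" "(g has_derivative g') (at x within S)"
  shows "((\<lambda>x. f x \<times> g x) has_derivative (\<lambda>h. f x \<times> g' h + f' h \<times> g x)) (at x within S)"
  using bounded_bilinear.FDERIV[OF bilinear_conv_bounded_bilinear[THEN iffD1, OF bilinear_cross] assms] .

text \<open>Implicit differentiation of \<open>J \<omega>' = \<dots>\<close> avoids the inverse of \<open>J\<close>. At the fixed point both \<open>\<omega>'\<close> and the arm vanish, so of the left-hand side
  only \<open>I\<close> applied to the derivative of \<open>\<omega>'\<close> is left, and of the term with \<open>arm_rate\<close> only
  the torque of gravity.\<close>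

lemma
  fixes a i1 i3 mu_r C :: real
  assumes pos: "i1 > 0" "i3 > 0"
  defines "D \<equiv> frechet_derivative (rolling_field a i1 i3 mu_r) (at (sigma_l i3 C))"
    and "\<omega> \<equiv> fst (sigma_l i3 C)" and "\<gamma> \<equiv> snd (sigma_l i3 C)"
  shows linearization_fst: "inertia i1 i3 *v fst (D (u, v)) =
      - (mu_r *\<^sub>R (\<gamma> \<times> (\<omega> \<times> v + u \<times> \<gamma>)))
      - (\<omega> \<times> (inertia i1 i3 *v u) + u \<times> (inertia i1 i3 *v \<omega>)) + arm a v"
    and linearization_snd: "snd (D (u, v)) = - (\<omega> \<times> v + u \<times> \<gamma>)"
proof -
  let ?F = "rolling_field a i1 i3 mu_r" and ?s = "sigma_l i3 C"
  let ?I = "\<lambda>x. inertia i1 i3 *v x"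
  have D: "(?F has_derivative D) (at ?s)"
    using rolling_field_differentiable[OF pos] by (simp add: D_def frechet_derivative_works)
  have F0: "?F ?s = 0" by (rule sigma_l_fixed_point[OF pos])
  have lin_arm: "arm a x = - (offset a \<times> x)" for x
    by (simp add: arm_def contact_def cross3_simps forall_3)
  have parallel: "\<omega> \<times> \<gamma> = 0" "\<gamma> \<times> \<omega> = 0" "offset a \<times> \<gamma> = 0"
    by (simp_all add: \<omega>_def \<gamma>_def sigma_l_def offset_def cross3_simps forall_3)
  have d\<omega>: "(fst has_derivative fst) (at ?s)" and d\<gamma>: "(snd has_derivative snd) (at ?s)"
    by (auto intro!: derivative_eq_intros)
  have dI: "((\<lambda>s. ?I (f s)) has_derivative (\<lambda>h. ?I (f' h))) (at ?s)"
    if "(f has_derivative f') (at ?s)" for f f'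
    by (rule bounded_linear.has_derivative[OF matrix_vector_mul_bounded_linear that])
  have eqs: "?I (fst (?F s)) + (arm a (snd s) \<bullet> fst (?F s)) *\<^sub>R arm a (snd s)
      = - (mu_r *\<^sub>R (snd s \<times> (fst s \<times> snd s))) - fst s \<times> ?I (fst s)
        - (fst s \<bullet> arm_rate a (fst s) (snd s) - 1) *\<^sub>R arm a (snd s)"
    and eqs2: "snd (?F s) = - (fst s \<times> snd s)" for s
  proof -
    have J: "J_mat a i1 i3 g *v x = ?I x + (arm a g \<bullet> x) *\<^sub>R arm a g" for g x
      by (simp add: J_mat_def dyad_def matrix_vector_mult_def sum_3 vec_eq_iff forall_3
          inner_vec_def algebra_simps)
    show "?I (fst (?F s)) + (arm a (snd s) \<bullet> fst (?F s)) *\<^sub>R arm a (snd s)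
      = - (mu_r *\<^sub>R (snd s \<times> (fst s \<times> snd s))) - fst s \<times> ?I (fst s)
        - (fst s \<bullet> arm_rate a (fst s) (snd s) - 1) *\<^sub>R arm a (snd s)"
      and "snd (?F s) = - (fst s \<times> snd s)"
      using rolling_equations_iff[OF pos, of a mu_r s "?F s"]
      by (auto simp: rolling_equations_def J case_prod_beta algebra_simps add_eq_0_iff)
  qed
  have dF: "((\<lambda>s. fst (?F s)) has_derivative (\<lambda>h. fst (D h))) (at ?s)"
    "((\<lambda>s. snd (?F s)) has_derivative (\<lambda>h. snd (D h))) (at ?s)"
    using has_derivative_fst[OF D] has_derivative_snd[OF D] by auto
  note rules = has_derivative_cross3 d\<omega> d\<gamma> dI dF derivative_intros
  have lhs: "((\<lambda>s. ?I (fst (?F s)) + (arm a (snd s) \<bullet> fst (?F s)) *\<^sub>R arm a (snd s))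
      has_derivative (\<lambda>h. ?I (fst (D h)))) (at ?s)"
    unfolding lin_arm
    by (rule has_derivative_eq_rhs, (rule rules)+)
       (simp add: F0 parallel flip: \<omega>_def \<gamma>_def)
  have rhs: "((\<lambda>s. - (mu_r *\<^sub>R (snd s \<times> (fst s \<times> snd s))) - fst s \<times> ?I (fst s)
        - (fst s \<bullet> arm_rate a (fst s) (snd s) - 1) *\<^sub>R arm a (snd s)) has_derivative
      (\<lambda>h. - (mu_r *\<^sub>R (\<gamma> \<times> (\<omega> \<times> snd h + fst h \<times> \<gamma>)))
        - (\<omega> \<times> ?I (fst h) + fst h \<times> ?I \<omega>) + arm a (snd h))) (at ?s)"
    unfolding lin_arm arm_rate_def
    by (rule has_derivative_eq_rhs, (rule rules)+)
       (simp add: parallel flip: \<omega>_def \<gamma>_def)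
  show "inertia i1 i3 *v fst (D (u, v)) =
      - (mu_r *\<^sub>R (\<gamma> \<times> (\<omega> \<times> v + u \<times> \<gamma>)))
      - (\<omega> \<times> (inertia i1 i3 *v u) + u \<times> (inertia i1 i3 *v \<omega>)) + arm a v"
    using fun_cong[OF has_derivative_unique[OF lhs[unfolded eqs] rhs], of "(u, v)"] by simp
  have "((\<lambda>s. - (fst s \<times> snd s)) has_derivative
      (\<lambda>h. - (\<omega> \<times> snd h + fst h \<times> \<gamma>))) (at ?s)"
    unfolding \<omega>_def \<gamma>_def by (rule rules)+
  from fun_cong[OF has_derivative_unique[OF dF(2)[unfolded eqs2] this], of "(u, v)"]
  show "snd (D (u, v)) = - (\<omega> \<times> v + u \<times> \<gamma>)" by simp
qed

lemma linearization_coordinates: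
  fixes a i1 i3 mu_r C :: real
  assumes pos: "i1 > 0" "i3 > 0"
  defines "\<Omega> \<equiv> - C / i3"
  shows "frechet_derivative (rolling_field a i1 i3 mu_r) (at (sigma_l i3 C)) (u, v) =
    (vector [- (mu_r / i1) * u $ 1 - ((i3 - i1) * \<Omega> / i1) * u $ 2
               - (mu_r / i1 * \<Omega>) * v $ 1 + (a / i1) * v $ 2,
             ((i3 - i1) * \<Omega> / i1) * u $ 1 - (mu_r / i1) * u $ 2
               - (a / i1) * v $ 1 - (mu_r / i1 * \<Omega>) * v $ 2,
             0],
     vector [u $ 2 + \<Omega> * v $ 2, - (u $ 1) - \<Omega> * v $ 1, 0])"
proof -
  define D where
    "D = frechet_derivative (rolling_field a i1 i3 mu_r) (at (sigma_l i3 C)) (u, v)"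
  have I: "inertia i1 i3 *v x = vector [i1 * x $ 1, i1 * x $ 2, i3 * x $ 3]" for x
    by (simp add: inertia_def matrix_vector_mult_def sum_3 vec_eq_iff forall_3)
  have s: "fst (sigma_l i3 C) = vector [0, 0, \<Omega>]" "snd (sigma_l i3 C) = vector [0, 0, - 1]"
    by (simp_all add: sigma_l_def \<Omega>_def)
  note eqs = linearization_fst[OF pos, of a mu_r C u v, folded D_def, unfolded I s]
    linearization_snd[OF pos, of a mu_r C u v, folded D_def, unfolded s]
  have "i1 * fst D $ 1 = - mu_r * u $ 1 - (i3 - i1) * \<Omega> * u $ 2 - mu_r * \<Omega> * v $ 1 + a * v $ 2"
    "i1 * fst D $ 2 = (i3 - i1) * \<Omega> * u $ 1 - mu_r * u $ 2 - a * v $ 1 - mu_r * \<Omega> * v $ 2"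
    "i3 * fst D $ 3 = 0"
    using eqs(1) by (simp_all add: vec_eq_iff forall_3 arm_eq cross3_def algebra_simps)
  then have "fst D $ 1 = (- mu_r * u $ 1 - (i3 - i1) * \<Omega> * u $ 2 - mu_r * \<Omega> * v $ 1 + a * v $ 2) / i1"
    "fst D $ 2 = ((i3 - i1) * \<Omega> * u $ 1 - mu_r * u $ 2 - a * v $ 1 - mu_r * \<Omega> * v $ 2) / i1"
    "fst D $ 3 = 0"
    using pos by (simp_all add: eq_divide_eq mult.commute)
  moreover have "snd D = vector [u $ 2 + \<Omega> * v $ 2, - (u $ 1) - \<Omega> * v $ 1, 0]"
    using eqs(2) by (simp add: vec_eq_iff forall_3 cross3_def)
  ultimately show ?thesis
    using pos unfolding D_def[symmetric]
    by (simp add: prod_eq_iff vec_eq_iff forall_3 diff_divide_distrib add_divide_distrib)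
qed

section \<open>The characteristic polynomial\<close>

text \<open>The complex number \<open>\<alpha> + \<i> \<beta>\<close> as a real matrix. The rotational symmetry makes every
  \<open>2 \<times> 2\<close> block of the linearization one of these; in particular, the blocks commute, so the
  determinant of a block matrix may be computed as if they were numbers.\<close>

definition complex_block :: "'a::comm_ring_1 \<Rightarrow> 'a \<Rightarrow> 'a mat" where
  "complex_block \<alpha> \<beta> = Matrix.mat 2 2 (\<lambda>(i, j). if i = j then \<alpha> else if i = 0 then - \<beta> else \<beta>)"

lemma complex_block_carrier [simp]: "complex_block \<alpha> \<beta> \<in> carrier_mat 2 2"
  by (simp add: complex_block_def)

lemma complex_block_mult:
  "complex_block \<alpha> \<beta> * complex_block \<gamma> \<delta> = complex_block (\<alpha> * \<gamma> - \<beta> * \<delta>) (\<alpha> * \<delta> + \<beta> * \<gamma>)"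
  by (intro eq_matI)
     (auto simp: complex_block_def scalar_prod_def numeral_2_eq_2 less_Suc_eq algebra_simps)

lemma complex_block_diff:
  "complex_block \<alpha> \<beta> - complex_block \<gamma> \<delta> = complex_block (\<alpha> - \<gamma>) (\<beta> - \<delta>)"
  by (intro eq_matI) (auto simp: complex_block_def less_2_cases_iff)

lemma det_complex_block: "Determinant.det (complex_block \<alpha> \<beta>) = \<alpha>\<^sup>2 + \<beta>\<^sup>2"
proof -
  have "mat_delete (complex_block \<alpha> \<beta>) 0 j \<in> carrier_mat 1 1" for j
    by (auto simp: complex_block_def mat_delete_def)
  then show ?thesis
    by (subst laplace_expansion_row[of _ 2 0])
       (auto simp: numeral_2_eq_2 cofactor_def det_single complex_block_def
         mat_delete_def power2_eq_square)
qed

text \<open>The rows of the vertical directions vanish. Of the remaining \<open>4 \<times> 4\<close> matrix the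
  characteristic polynomial is the squared modulus of the determinant of a complex \<open>2 \<times> 2\<close>
  matrix; the summands below are the squares of the real and the imaginary part.\<close>

lemma char_poly_jacobian:
  fixes a i1 i3 mu_r C :: real
  assumes pos: "i1 > 0" "i3 > 0"
  defines "\<Omega> \<equiv> - C / i3"
  defines "m \<equiv> mu_r / i1" and "d \<equiv> (i3 - i1) * \<Omega> / i1" and "e \<equiv> a / i1"
  shows "char_poly (jacobian_mat (rolling_field a i1 i3 mu_r) (sigma_l i3 C)) =
    monom 1 2 * ([:e + d * \<Omega>, m, 1:]\<^sup>2 + [:0, \<Omega> - d:]\<^sup>2)"
proof -
  define A where "A = jacobian_mat (rolling_field a i1 i3 mu_r) (sigma_l i3 C)"
  define B where "B = mat_delete A 5 5"
  define R where "R = mat_delete B 2 2"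
  have A: "A \<in> carrier_mat 6 6" by (simp add: A_def jacobian_mat_def)
  then have B: "B \<in> carrier_mat 5 5" by (auto simp: B_def mat_delete_def)
  then have R: "R \<in> carrier_mat 4 4" by (auto simp: R_def mat_delete_def)
  have "char_poly A = [:0, 1:] * char_poly B"
    unfolding B_def
    by (rule char_poly_zero_row[where n = 5])
       (use A in \<open>auto simp: A_def intro!: jacobian_row_zero[OF pos]\<close>)
  also have "char_poly B = [:0, 1:] * char_poly R"
    unfolding R_def
  proof (rule char_poly_zero_row[where n = 4])
    show "B $$ (2, j) = 0" if "j \<le> 4" for j
      using A that jacobian_row_zero[OF pos, of 2 j a mu_r C]
      by (simp add: B_def mat_delete_def A_def)
  qed (use B in auto)
  also have "char_poly R = [:e + d * \<Omega>, m, 1:]\<^sup>2 + [:0, \<Omega> - d:]\<^sup>2"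
  proof -
    \<comment> \<open>Deleting indices 2 and 5 leaves the horizontal parts of \<open>\<omega>\<close> and \<open>\<gamma>\<close>, in this order.\<close>
    define blocks where "blocks = four_block_mat (complex_block [:m, 1:] [:- d:])
      (complex_block [:m * \<Omega>:] [:e:]) (complex_block 0 1) (complex_block [:0, 1:] [:\<Omega>:])"
    have entry: "R $$ (i, j) = frechet_derivative (rolling_field a i1 i3 mu_r) (at (sigma_l i3 C))
        (state_basis ! (if j < 2 then j else Suc j)) \<bullet> (state_basis ! (if i < 2 then i else Suc i))"
      if "i < 4" "j < 4" for i j
      using that A B by (auto simp: R_def B_def A_def mat_delete_def jacobian_mat_def)
    note D = linearization_coordinates[OF pos, of a mu_r C, folded \<Omega>_def]
    have axis_nth: "axis k (1 :: real) $ l = (if l = k then 1 else 0)" for k l :: 3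
      by (simp add: axis_def)
    have cases4: "i < 4 \<longleftrightarrow> i = 0 \<or> i = 1 \<or> i = 2 \<or> i = 3" for i :: nat by auto
    have "char_poly_matrix R = blocks"
    proof (rule eq_matI)
      fix i j assume "i < dim_row blocks" "j < dim_col blocks"
      then have ij: "i < 4" "j < 4"
        by (simp_all add: blocks_def complex_block_def)
      have "char_poly_matrix R $$ (i, j) = (if i = j then [:0, 1:] else 0) - [:R $$ (i, j):]"
        using R ij by (simp add: char_poly_matrix_def)
      also have "\<dots> = blocks $$ (i, j)"
        using ij unfolding entry[OF ij] unfolding cases4
        by (elim disjE)
           (simp_all add: state_basis_def D inner_axis axis_nth blocks_def
             complex_block_def m_def d_def e_def one_pCons)
      finally show "char_poly_matrix R $$ (i, j) = blocks $$ (i, j)" .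
    qed (use R in \<open>auto simp: blocks_def complex_block_def char_poly_matrix_def\<close>)
    then have "char_poly R = Determinant.det blocks" by (simp add: char_poly_def)
    also have "\<dots> = Determinant.det (complex_block [:m, 1:] [:- d:] * complex_block [:0, 1:] [:\<Omega>:]
        - complex_block [:m * \<Omega>:] [:e:] * complex_block 0 1)"
      unfolding blocks_def
      by (rule det_four_block_mat[where n = 2]) (simp_all add: complex_block_mult algebra_simps)
    also have "\<dots> = [:e + d * \<Omega>, m, 1:]\<^sup>2 + [:0, \<Omega> - d:]\<^sup>2"
      by (simp add: complex_block_mult complex_block_diff det_complex_block algebra_simps)
    finally show ?thesis .
  qed
  finally show ?thesis
    by (simp add: A_def monom_altdef power2_eq_square algebra_simps)
qed

section \<open>Location of the roots\<close>

text \<open>The quartic is \<open>q b z * q (cnj b) z\<close> with \<open>q b z = z\<^sup>2 + b z + k\<close>. If \<open>k > 0\<close> and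
  \<open>Re z \<ge> 0\<close>, then \<open>z + b + k / z = 0\<close> is impossible, since \<open>z\<close> and \<open>k / z\<close> have nonnegative
  real parts and \<open>Re b = m > 0\<close>. If \<open>k \<le> 0\<close>, then of the two roots \<open>z\<close> and \<open>k / z\<close> of \<open>q b\<close>
  one has a nonnegative real part.\<close>

lemma quartic_left_half_plane_iff:
  fixes m n k :: real
  assumes m: "m > 0"
  shows "(\<forall>z :: complex. (z\<^sup>2 + of_real m * z + of_real k)\<^sup>2 + (of_real n * z)\<^sup>2 = 0 \<longrightarrow> Re z < 0)
    \<longleftrightarrow> k > 0"
proof -
  define q where "q b z = z\<^sup>2 + b * z + of_real k" for b z :: complex
  define b where "b = complex_of_real m + \<i> * of_real n"
  have factor: "(z\<^sup>2 + of_real m * z + of_real k)\<^sup>2 + (of_real n * z)\<^sup>2 = q b z * q (cnj b) z" for z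
    unfolding q_def b_def by (simp add: algebra_simps power2_eq_square)
  have left: "Re z < 0" if k: "k > 0" and c: "Re c > 0" and z: "q c z = 0" for c z
  proof (rule ccontr)
    assume "\<not> Re z < 0"
    then have Re_z: "Re z \<ge> 0" by simp
    have "z \<noteq> 0" using z k by (auto simp: q_def)
    have "(z + c + of_real k / z) * z = 0"
      using z \<open>z \<noteq> 0\<close> by (simp add: q_def field_simps power2_eq_square)
    then have "Re (z + c + of_real k / z) = 0" using \<open>z \<noteq> 0\<close> by simp
    moreover have "Re (of_real k / z) = k * Re z / (cmod z)\<^sup>2"
      by (simp add: Re_divide cmod_power2)
    moreover have "k * Re z / (cmod z)\<^sup>2 \<ge> 0" using k Re_z by simp
    ultimately show False using Re_z c by simp
  qed
  have right: "\<exists>z. q b z = 0 \<and> Re z \<ge> 0" if k: "k \<le> 0"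
  proof -
    define z where "z = (csqrt (b\<^sup>2 - 4 * of_real k) - b) / 2"
    have "2 * z + b = csqrt (b\<^sup>2 - 4 * of_real k)" by (simp add: z_def field_simps)
    then have "(2 * z + b)\<^sup>2 = b\<^sup>2 - 4 * of_real k" by simp
    moreover have "4 * q b z = (2 * z + b)\<^sup>2 - (b\<^sup>2 - 4 * of_real k)"
      by (simp add: q_def power2_eq_square algebra_simps)
    ultimately have z: "q b z = 0" by simp
    show ?thesis
    proof (cases "z = 0")
      case True
      with z show ?thesis by (intro exI[of _ z]) simp
    next
      case False
      define z' where "z' = of_real k / z"
      have "of_real k - (- b - z) * z = q b z"
        by (simp add: q_def power2_eq_square algebra_simps)
      with z False have "z' = - b - z" by (simp add: z'_def divide_eq_eq)
      moreover have "q b (- b - z) = q b z" by (simp add: q_def power2_eq_square algebra_simps)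
      ultimately have "q b z' = q b z" by simp
      moreover have "Re z' = k * Re z / (cmod z)\<^sup>2"
        by (simp add: z'_def Re_divide cmod_power2)
      then have "Re z < 0 \<Longrightarrow> Re z' \<ge> 0"
        using k by (simp add: mult_nonpos_nonpos)
      ultimately show ?thesis using z by (metis not_less)
    qed
  qed
  have "Re b > 0" "Re (cnj b) > 0" using m by (simp_all add: b_def)
  then show ?thesis
    unfolding factor using left right by (metis mult_eq_0_iff not_less)
qed

text \<open>The factor \<open>P4\<close> in the definition of stability is unique because the polynomial ring has no
  zero divisors.\<close>

lemma linearly_stable_sigma_l_iff:
  fixes a i1 i3 mu_r C :: real
  assumes pos: "i1 > 0" "i3 > 0" and mu: "mu_r > 0"
  shows "linearly_stable (rolling_field a i1 i3 mu_r) (sigma_l i3 C) \<longleftrightarrow>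
    a + (i3 - i1) * (C / i3)\<^sup>2 > 0"
proof -
  define \<Omega> m d e where "\<Omega> = - C / i3" and "m = mu_r / i1" and "d = (i3 - i1) * \<Omega> / i1"
    and "e = a / i1"
  define Q where "Q = [:e + d * \<Omega>, m, 1:]\<^sup>2 + [:0, \<Omega> - d:]\<^sup>2"
  have "char_poly (jacobian_mat (rolling_field a i1 i3 mu_r) (sigma_l i3 C)) = monom 1 2 * Q"
    using char_poly_jacobian[OF pos, of a mu_r C] by (simp add: Q_def e_def d_def m_def \<Omega>_def)
  moreover have "monom 1 2 * Q = monom 1 2 * P \<longleftrightarrow> P = Q" for P :: "real poly"
    by auto
  ultimately have "linearly_stable (rolling_field a i1 i3 mu_r) (sigma_l i3 C) \<longleftrightarrow>
      (\<forall>z :: complex. poly (map_poly complex_of_real Q) z = 0 \<longrightarrow> Re z < 0)"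
    by (simp add: linearly_stable_def)
  moreover have "poly (map_poly complex_of_real Q) z =
      (z\<^sup>2 + of_real m * z + of_real (e + d * \<Omega>))\<^sup>2 + (of_real (\<Omega> - d) * z)\<^sup>2" for z
    by (simp add: Q_def map_poly_pCons algebra_simps power2_eq_square)
  moreover have "m > 0" using pos mu by (simp add: m_def)
  moreover have "e + d * \<Omega> = (a + (i3 - i1) * (C / i3)\<^sup>2) / i1"
    using pos by (simp add: e_def d_def \<Omega>_def field_simps power2_eq_square)
  ultimately show ?thesis
    using pos quartic_left_half_plane_iff[where m = m and n = "\<Omega> - d" and k = "e + d * \<Omega>"]
    by (simp add: zero_less_divide_iff)
qed

theorem mainTheorem3:
  fixes a i1 i3 mu_r C :: real
  assumes "a > 0" and "i1 > 0" and "i3 > 0" and "mu_r > 0"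
  shows "(i1 \<le> i3 \<longrightarrow> linearly_stable (rolling_field a i1 i3 mu_r) (sigma_l i3 C)) \<and>
         (i1 > i3 \<longrightarrow>
            (linearly_stable (rolling_field a i1 i3 mu_r) (sigma_l i3 C) \<longleftrightarrow> \<bar>C\<bar> < C_star a i1 i3))"
  unfolding linearly_stable_sigma_l_iff[OF assms(2-4)]
proof (intro conjI impI)
  assume "i1 \<le> i3"
  then have "(i3 - i1) * (C / i3)\<^sup>2 \<ge> 0" by simp
  with assms show "a + (i3 - i1) * (C / i3)\<^sup>2 > 0" by linarith
next
  assume less: "i3 < i1"
  have "a + (i3 - i1) * (C / i3)\<^sup>2 > 0 \<longleftrightarrow> C\<^sup>2 < i3\<^sup>2 * a / (i1 - i3)"
    using less assms by (simp add: field_simps power2_eq_square)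
  also have "i3\<^sup>2 * a / (i1 - i3) = (C_star a i1 i3)\<^sup>2"
    using less assms by (simp add: C_star_def power_divide power_mult_distrib)
  also have "C\<^sup>2 < (C_star a i1 i3)\<^sup>2 \<longleftrightarrow> \<bar>C\<bar> < \<bar>C_star a i1 i3\<bar>"
    by (simp add: abs_le_square_iff flip: not_le)
  also have "\<bar>C_star a i1 i3\<bar> = C_star a i1 i3"
    using less assms by (simp add: C_star_def)
  finally show "a + (i3 - i1) * (C / i3)\<^sup>2 > 0 \<longleftrightarrow> \<bar>C\<bar> < C_star a i1 i3" .
qed

end
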